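(* Let $X$ be a path connected, locally path connected space and let $p:\widetilde{X}\to X$ be a Spanier covering of $X$. Then $p$ is the universal object in the category $\mathcal{COV}(X)$; that is, for every covering $q:\widetilde{Y}\to X$ with $\widetilde{Y}$ path connected there exists a covering $r:\widetilde{X}\to\widetilde{Y}$ such that $q\circ r=p$.
   Context: A covering $p:\widetilde{X}\to X$ is a continuous map such that every $x\in X$ has an open neighborhood $U$ that is evenly covered, i.e. $p^{-1}(U)$ is a disjoint union of open subsets of $\widetilde{X}$ each mapped homeomorphically onto $U$ by $p$. All spaces and covering spaces are path connected; homotopies of paths are relative to endpoints. $\mathcal{COV}(X)$ is the category whose objects are the coverings of $X$ and whose morphisms are the covering maps between them. Spanier group: for an open cover $\mathcal{U}$ of a space $X$, $\pi(\mathcal{U},x)\le\pi_1(X,x)$ is the subgroup of classes having a representative of the form $\prod_{j=1}^n u_j v_j u_j^{-1}$, with $u_j$ a path starting at $x$ and $v_j$ a loop based at $u_j(1)$ lying inside some $U_j\in\mathcal{U}$. Then $\pi_1^{sp}(X,x)=\bigcap_{\mathcal{U}}\pi(\mathcal{U},x)$ over all open covers $\mathcal{U}$. A space $X$ is a Spanier space if $\pi_1(X,x)=\pi_1^{sp}(X,x)$ for every $x\in X$. A Spanier covering of $X$ is a covering $p:\widetilde{X}\to X$ such that $\widetilde{X}$ is a Spanier space. *)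

theory Defs
  imports "HOL-Analysis.Analysis"
begin

text \<open>
  A space is a subset \<open>S\<close> of a type of class \<open>topological_space\<close>, with the subspace topology
  (\<open>S = UNIV\<close> is allowed, so every topological space is covered, up to homeomorphism).
  The library predicate \<open>covering_space C p S\<close> says that \<open>p\<close> is a covering map from \<open>C\<close> onto \<open>S\<close>;
  surjectivity is automatic when \<open>C\<close> and \<open>S\<close> are nonempty and \<open>S\<close> is connected.
  No type-independent collection of all coverings of \<open>S\<close> can be formed in HOL, so the category of
  coverings is not an object here: quantification over it is quantification over maps, spaces
  and their types.
\<close>

definition loops_at :: "'a::topological_space set \<Rightarrow> 'a \<Rightarrow> (real \<Rightarrow> 'a) set" where
  "loops_at S x = {g. path g \<and> path_image g \<subseteq> S \<and> pathstart g = x \<and> pathfinish g = x}"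

definition path_class :: "'a::topological_space set \<Rightarrow> (real \<Rightarrow> 'a) \<Rightarrow> (real \<Rightarrow> 'a) set" where
  "path_class S g = {h. homotopic_paths S g h}"

text \<open>
  The fundamental group enters only through equality of a subgroup with the whole group, which
  is equality of the underlying sets of homotopy classes; so both groups are given as such sets.
\<close>

definition fundamental_group :: "'a::topological_space set \<Rightarrow> 'a \<Rightarrow> (real \<Rightarrow> 'a) set set" where
  "fundamental_group S x = path_class S ` loops_at S x"

definition open_cover :: "'a::topological_space set set \<Rightarrow> 'a set \<Rightarrow> bool" where
  "open_cover \<U> S \<longleftrightarrow> (\<forall>U\<in>\<U>. openin (top_of_set S) U) \<and> \<Union>\<U> = S"

text \<open>
  The product of \<open>u\<^sub>j v\<^sub>j u\<^sub>j\<^sup>-\<^sup>1\<close> over a list of pairs \<open>(u\<^sub>j, v\<^sub>j)\<close>. Bracketing and the final constant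
  path do not affect the homotopy class.
\<close>

definition conj_product :: "'a::topological_space \<Rightarrow> ((real \<Rightarrow> 'a) \<times> (real \<Rightarrow> 'a)) list \<Rightarrow> real \<Rightarrow> 'a" where
  "conj_product x uvs = foldr (\<lambda>(u, v) g. (u +++ v +++ reversepath u) +++ g) uvs (\<lambda>_. x)"

definition spanier_group_cover ::
  "'a::topological_space set \<Rightarrow> 'a set set \<Rightarrow> 'a \<Rightarrow> (real \<Rightarrow> 'a) set set" where
  "spanier_group_cover S \<U> x =
     {path_class S (conj_product x uvs) | uvs.
        \<forall>(u, v) \<in> set uvs.
          path u \<and> path_image u \<subseteq> S \<and> pathstart u = x \<and>
          (\<exists>U\<in>\<U>. v \<in> loops_at U (pathfinish u))}"

definition spanier_group :: "'a::topological_space set \<Rightarrow> 'a \<Rightarrow> (real \<Rightarrow> 'a) set set" where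
  "spanier_group S x = (\<Inter>\<U>\<in>{\<U>. open_cover \<U> S}. spanier_group_cover S \<U> x)"

definition spanier_space :: "'a::topological_space set \<Rightarrow> bool" where
  "spanier_space S \<longleftrightarrow> (\<forall>x\<in>S. fundamental_group S x = spanier_group S x)"

definition spanier_covering ::
  "'a::topological_space set \<Rightarrow> ('a \<Rightarrow> 'b::topological_space) \<Rightarrow> 'b set \<Rightarrow> bool" where
  "spanier_covering C p S \<longleftrightarrow> covering_space C p S \<and> spanier_space C"

end

theory Submission
  imports Defs
begin

text \<open>
  Cover \<open>Xt\<close> by the \<open>p\<close>-preimages of the sets evenly covered by \<open>q\<close>. As \<open>Xt\<close> is a Spanier space, every
  loop in it is homotopic to a product of conjugates \<open>u v u\<^sup>-\<^sup>1\<close> with \<open>v\<close> inside one of these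
  preimages; such a \<open>v\<close> is sent to a loop in an evenly covered set, so the \<open>q\<close>-lift of the product
  closes up. Hence the endpoint of the \<open>q\<close>-lift of \<open>p \<circ> g\<close> depends only on the endpoint of the path \<open>g\<close>,
  which defines a lift \<open>r\<close> of \<open>p\<close> through \<open>q\<close>. Locally \<open>r\<close> is \<open>p\<close> followed by the inverse of a sheet of
  \<open>q\<close>, so it is continuous and itself a covering.
\<close>

subsection \<open>Evenly covered sets\<close>

text \<open>The local condition inside \<open>covering_space\<close>, isolated for a single set
  \<open>T\<close> so that it can be passed on to smaller open sets and verified for a new covering
  map.\<close>

definition evenly_covered ::
  "'a::topological_space set \<Rightarrow> ('a \<Rightarrow> 'b::topological_space) \<Rightarrow> 'b set \<Rightarrow> 'b set \<Rightarrow> bool" where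
  "evenly_covered C p S T \<longleftrightarrow> openin (top_of_set S) T \<and>
     (\<exists>\<V>. \<Union>\<V> = C \<inter> p -` T \<and> (\<forall>u\<in>\<V>. openin (top_of_set C) u) \<and> pairwise disjnt \<V> \<and>
          (\<forall>u\<in>\<V>. \<exists>s. homeomorphism u T p s))"

lemma covering_space_iff_evenly_covered:
  "covering_space C p S \<longleftrightarrow>
     continuous_on C p \<and> p ` C = S \<and> (\<forall>x\<in>S. \<exists>T. x \<in> T \<and> evenly_covered C p S T)"
  unfolding covering_space_def evenly_covered_def by auto

lemma covering_space_evenly_coveredE:
  assumes "covering_space C p S" "x \<in> S"
  obtains T where "x \<in> T" "evenly_covered C p S T"
  using assms covering_space_iff_evenly_covered by metis

lemma covering_space_funcset: "covering_space C p S \<Longrightarrow> p \<in> C \<rightarrow> S"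
  by (auto simp: covering_space_def)

lemma evenly_covered_openin: "evenly_covered C p S T \<Longrightarrow> openin (top_of_set S) T"
  by (simp add: evenly_covered_def)

lemma evenly_coveredE:
  assumes "evenly_covered C p S T"
  obtains \<V> where "\<Union>\<V> = C \<inter> p -` T" "\<And>u. u \<in> \<V> \<Longrightarrow> openin (top_of_set C) u"
    "pairwise disjnt \<V>" "\<And>u. u \<in> \<V> \<Longrightarrow> \<exists>s. homeomorphism u T p s"
  using assms unfolding evenly_covered_def
  by (elim conjE exE, intro that) (assumption | erule (1) bspec)+

lemma homeomorphism_restrict_preimage:
  assumes "homeomorphism u T p s" "W \<subseteq> T"
  shows "homeomorphism (u \<inter> p -` W) W p s"
proof (rule homeomorphism_of_subsets[OF assms(1)])
  show "p ` (u \<inter> p -` W) = W"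
    using assms unfolding homeomorphism_def by force
qed (use assms in auto)

text \<open>The sheets over \<open>W\<close> are the sheets over \<open>T\<close> cut down to the
  preimage of \<open>W\<close>. Evenly covered sets can thus be shrunk to path connected
  ones.\<close>

lemma evenly_covered_subset:
  assumes T: "evenly_covered C p S T" and W: "W \<subseteq> T" "openin (top_of_set S) W"
    and p: "continuous_on C p" "p \<in> C \<rightarrow> S"
  shows "evenly_covered C p S W"
proof -
  obtain \<V> where \<V>: "\<Union>\<V> = C \<inter> p -` T" "\<And>u. u \<in> \<V> \<Longrightarrow> openin (top_of_set C) u"
      "pairwise disjnt \<V>" "\<And>u. u \<in> \<V> \<Longrightarrow> \<exists>s. homeomorphism u T p s"
    using evenly_coveredE[OF T] by metis
  have pre: "openin (top_of_set C) (C \<inter> p -` W)"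
    using continuous_openin_preimage[OF p W(2)] .
  let ?\<W> = "(\<lambda>u. u \<inter> p -` W) ` \<V>"
  have "\<Union>?\<W> = C \<inter> p -` W"
    using \<V>(1) W(1) by blast
  moreover have "openin (top_of_set C) (u \<inter> p -` W)" if "u \<in> \<V>" for u
  proof -
    have "u \<inter> p -` W = u \<inter> (C \<inter> p -` W)"
      using \<V>(1) that by blast
    then show ?thesis
      using openin_Int[OF \<V>(2)[OF that] pre] by simp
  qed
  moreover have "pairwise disjnt ?\<W>"
    using \<V>(3) unfolding pairwise_def disjnt_def by blast
  moreover have "\<exists>s. homeomorphism (u \<inter> p -` W) W p s" if "u \<in> \<V>" for u
    using \<V>(4)[OF that] homeomorphism_restrict_preimage W(1) by blast
  ultimately show ?thesis
    unfolding evenly_covered_def using W(2) by (intro conjI exI[of _ ?\<W>]) auto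
qed

lemma evenly_covered_sheetE:
  assumes "evenly_covered C p S T" "a \<in> C" "p a \<in> T"
  obtains u s where "a \<in> u" "openin (top_of_set C) u" "homeomorphism u T p s"
proof -
  obtain \<V> where \<V>: "\<Union>\<V> = C \<inter> p -` T" "\<And>u. u \<in> \<V> \<Longrightarrow> openin (top_of_set C) u"
      "\<And>u. u \<in> \<V> \<Longrightarrow> \<exists>s. homeomorphism u T p s"
    using evenly_coveredE[OF assms(1)] by metis
  have "a \<in> \<Union>\<V>" using \<V>(1) assms by auto
  then obtain u where u: "u \<in> \<V>" "a \<in> u" by (rule UnionE)
  with \<V>(3) obtain s where "homeomorphism u T p s" by metis
  with that u \<V>(2) show ?thesis by metis
qed

text \<open>Each sheet contains at most one point of a fibre, so distinct points of a fibre lie in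
  different sheets, and these are disjoint.\<close>

lemma evenly_covered_separateE:
  assumes "evenly_covered C p S T" "a \<in> C" "b \<in> C" "p a = p b" "p a \<in> T" "a \<noteq> b"
  obtains u v where "a \<in> u" "b \<in> v" "openin (top_of_set C) u" "openin (top_of_set C) v" "u \<inter> v = {}"
proof -
  obtain \<V> where \<V>: "\<Union>\<V> = C \<inter> p -` T" "\<And>u. u \<in> \<V> \<Longrightarrow> openin (top_of_set C) u"
      "pairwise disjnt \<V>" "\<And>u. u \<in> \<V> \<Longrightarrow> \<exists>s. homeomorphism u T p s"
    using evenly_coveredE[OF assms(1)] by metis
  have "a \<in> \<Union>\<V>" "b \<in> \<Union>\<V>" using \<V>(1) assms by auto
  then obtain u v where uv: "u \<in> \<V>" "a \<in> u" "v \<in> \<V>" "b \<in> v" by blast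
  have "u \<noteq> v"
    using uv \<V>(4) assms(4,6) unfolding homeomorphism_def by metis
  then have "u \<inter> v = {}"
    using \<V>(3) uv unfolding pairwise_def disjnt_def by blast
  with uv \<V>(2) that show ?thesis by blast
qed

text \<open>An evenly covered set is shrunk inside \<open>N\<close> by local path connectedness.
  When \<open>N\<close> is evenly covered by a second covering, \<open>W\<close> serves both, and
  the sheets over it are connected.\<close>

lemma covering_space_locally_path_connected_nhd:
  assumes cov: "covering_space C p S" and S: "locally path_connected S"
    and N: "openin (top_of_set S) N" "x \<in> N"
  obtains W where "x \<in> W" "W \<subseteq> N" "path_connected W" "evenly_covered C p S W"
proof -
  have "x \<in> S" using N openin_imp_subset by blast
  then obtain T where T: "x \<in> T" "evenly_covered C p S T"
    using covering_space_evenly_coveredE[OF cov] by blast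
  have "openin (top_of_set S) (T \<inter> N)" "x \<in> T \<inter> N"
    using T N evenly_covered_openin by blast+
  then obtain W where "openin (top_of_set S) W" "path_connected W" "x \<in> W" "W \<subseteq> T \<inter> N"
    using S unfolding locally_path_connected by metis
  then show ?thesis
    using that evenly_covered_subset[OF T(2)] covering_space_imp_continuous[OF cov]
      covering_space_funcset[OF cov] by (metis le_inf_iff)
qed

subsection \<open>Lifting in arbitrary topological spaces\<close>

text \<open>
  The lifting theorems of the library assume normed vector spaces, which is why lifts are
  constructed here from scratch.
\<close>

lemma covering_space_lift_unique_connected:
  assumes cov: "covering_space C p S"
    and g1: "continuous_on A g1" "g1 \<in> A \<rightarrow> C" and g2: "continuous_on A g2" "g2 \<in> A \<rightarrow> C"
    and eq: "\<And>x. x \<in> A \<Longrightarrow> p (g1 x) = p (g2 x)"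
    and A: "connected A" "a \<in> A" "g1 a = g2 a" "x \<in> A"
  shows "g1 x = g2 x"
proof -
  let ?E = "{x \<in> A. g1 x = g2 x}" and ?D = "{x \<in> A. g1 x \<noteq> g2 x}"
  have T: "\<exists>T. p (g1 x) \<in> T \<and> evenly_covered C p S T" if "x \<in> A" for x
    using covering_space_evenly_coveredE[OF cov] covering_space_funcset[OF cov] g1(2) that
    by (metis PiE)
  note pre1 = continuous_openin_preimage[OF g1] and pre2 = continuous_openin_preimage[OF g2]
  \<comment> \<open>Near a point of agreement both maps stay in one sheet, where \<open>p\<close> is
    injective.\<close>
  have "openin (top_of_set A) ?E"
  proof (subst openin_subopen, intro ballI)
    fix x assume x: "x \<in> ?E"
    then obtain T where T: "p (g1 x) \<in> T" "evenly_covered C p S T" using T by blast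
    moreover have "g1 x \<in> C" using g1(2) x by blast
    ultimately obtain u s where u: "g1 x \<in> u" "openin (top_of_set C) u" "homeomorphism u T p s"
      using evenly_covered_sheetE by metis
    let ?N = "(A \<inter> g1 -` u) \<inter> (A \<inter> g2 -` u)"
    have "openin (top_of_set A) ?N"
      using pre1[OF u(2)] pre2[OF u(2)] by (rule openin_Int)
    moreover have "x \<in> ?N" using x u(1) by auto
    moreover have "?N \<subseteq> ?E"
    proof
      fix w assume "w \<in> ?N"
      then have w: "w \<in> A" "g1 w \<in> u" "g2 w \<in> u" by auto
      have "g1 w = s (p (g1 w))" using homeomorphism_apply1[OF u(3) w(2)] by (rule sym)
      also have "\<dots> = g2 w" unfolding eq[OF w(1)] by (rule homeomorphism_apply1[OF u(3) w(3)])
      finally show "w \<in> ?E" using w by simp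
    qed
    ultimately show "\<exists>N. openin (top_of_set A) N \<and> x \<in> N \<and> N \<subseteq> ?E" by blast
  qed
  \<comment> \<open>Near a point of disagreement the two maps stay in disjoint sheets. The sheets
    supply the separation that a Hausdorff space \<open>C\<close> would give.\<close>
  moreover have "openin (top_of_set A) ?D"
  proof (subst openin_subopen, intro ballI)
    fix x assume x: "x \<in> ?D"
    then obtain T where T: "p (g1 x) \<in> T" "evenly_covered C p S T" using T by blast
    have "g1 x \<in> C" "g2 x \<in> C" "p (g1 x) = p (g2 x)" "g1 x \<noteq> g2 x"
      using g1 g2 x eq by auto
    then obtain u v where uv: "g1 x \<in> u" "g2 x \<in> v" "openin (top_of_set C) u"
        "openin (top_of_set C) v" "u \<inter> v = {}"
      using evenly_covered_separateE[OF T(2)] T(1) by metis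
    let ?N = "(A \<inter> g1 -` u) \<inter> (A \<inter> g2 -` v)"
    have "openin (top_of_set A) ?N"
      using pre1[OF uv(3)] pre2[OF uv(4)] by (rule openin_Int)
    moreover have "x \<in> ?N" using x uv by auto
    moreover have "?N \<subseteq> ?D" using uv(5) by auto
    ultimately show "\<exists>N. openin (top_of_set A) N \<and> x \<in> N \<and> N \<subseteq> ?D" by blast
  qed
  moreover have "A \<subseteq> ?E \<union> ?D" "?E \<inter> ?D = {}" "?E \<noteq> {}"
    using A by auto
  ultimately have "?D = {}"
    using A(1) unfolding connected_openin by blast
  then show ?thesis using A by blast
qed

section \<open>Gluing lifts over closed pieces\<close>

text \<open>Both the point \<open>z\<close> and the prescribed value \<open>a\<close> over it are
  arbitrary, so that a lift over one piece can be continued from whatever value it reaches on the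
  edge of a neighbouring piece.\<close>

definition liftable_on ::
  "'a::topological_space set \<Rightarrow> ('a \<Rightarrow> 'b) \<Rightarrow> 'c::topological_space set \<Rightarrow> ('c \<Rightarrow> 'b) \<Rightarrow> bool" where
  "liftable_on C p A f \<longleftrightarrow> (\<forall>z\<in>A. \<forall>a\<in>C. p a = f z \<longrightarrow>
     (\<exists>k. continuous_on A k \<and> k \<in> A \<rightarrow> C \<and> k z = a \<and> (\<forall>w\<in>A. p (k w) = f w)))"

lemma liftable_onE:
  assumes "liftable_on C p A f" "z \<in> A" "a \<in> C" "p a = f z"
  obtains k where "continuous_on A k" "k \<in> A \<rightarrow> C" "k z = a" "\<And>w. w \<in> A \<Longrightarrow> p (k w) = f w"
  using assms unfolding liftable_on_def by metis

text \<open>The sheet through the prescribed value carries the lift: \<open>f\<close> is composed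
  with the inverse \<open>s\<close> of \<open>p\<close> on that sheet. This is the small case from
  which larger lifts are glued.\<close>

lemma liftable_on_evenly_covered:
  assumes T: "evenly_covered C p S T" and f: "continuous_on A f" "f \<in> A \<rightarrow> T"
  shows "liftable_on C p A f"
  unfolding liftable_on_def
proof (intro ballI impI)
  fix z a assume za: "z \<in> A" "a \<in> C" "p a = f z"
  moreover have "p a \<in> T" using za f by auto
  ultimately obtain u s where u: "a \<in> u" "openin (top_of_set C) u" "homeomorphism u T p s"
    using evenly_covered_sheetE[OF T] by metis
  have "continuous_on A (s \<circ> f)"
    using f u(3) by (metis continuous_on_compose continuous_on_subset homeomorphism_def image_subset_iff_funcset)
  moreover have "s \<circ> f \<in> A \<rightarrow> C"
    using f(2) openin_imp_subset[OF u(2)] homeomorphism_image2[OF u(3)] by fastforce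
  moreover have "(s \<circ> f) z = a"
    using za u homeomorphism_apply1 by fastforce
  moreover have "p ((s \<circ> f) w) = f w" if "w \<in> A" for w
    using that f homeomorphism_apply2[OF u(3)] by auto
  ultimately show "\<exists>k. continuous_on A k \<and> k \<in> A \<rightarrow> C \<and> k z = a \<and> (\<forall>w\<in>A. p (k w) = f w)"
    by blast
qed

text \<open>The lift over one set fixes, at a common point, the starting value of a lift over the
  other. Uniqueness on the connected intersection makes the two agree there, and closedness makes
  the pasted map continuous.\<close>

lemma liftable_on_Un:
  assumes cov: "covering_space C p S" and A: "liftable_on C p A f" and B: "liftable_on C p B f"
    and "closed A" "closed B" and conn: "connected (A \<inter> B)" "A \<inter> B \<noteq> {}"
  shows "liftable_on C p (A \<union> B) f"
proof -
  \<comment> \<open>Stated for fresh sets, because a start \<open>z\<close> in \<open>B\<close>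
    needs the roles of \<open>A\<close> and \<open>B\<close> exchanged.\<close>
  have half: "\<exists>k. continuous_on (A \<union> B) k \<and> k \<in> A \<union> B \<rightarrow> C \<and> k z = a \<and> (\<forall>w\<in>A \<union> B. p (k w) = f w)"
    if A: "liftable_on C p A f" and B: "liftable_on C p B f" and cl: "closed A" "closed B"
      and conn: "connected (A \<inter> B)" "A \<inter> B \<noteq> {}" and za: "z \<in> A" "a \<in> C" "p a = f z"
    for A B z a
  proof -
    obtain k where k: "continuous_on A k" "k \<in> A \<rightarrow> C" "k z = a" "\<And>w. w \<in> A \<Longrightarrow> p (k w) = f w"
      using liftable_onE[OF A za] by blast
    obtain c where c: "c \<in> A" "c \<in> B" using conn by blast
    have "k c \<in> C" "p (k c) = f c" using k c by auto
    then obtain l where l: "continuous_on B l" "l \<in> B \<rightarrow> C" "l c = k c" "\<And>w. w \<in> B \<Longrightarrow> p (l w) = f w"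
      using liftable_onE[OF B c(2)] by blast
    have eq: "k w = l w" if "w \<in> A \<inter> B" for w
    proof (rule covering_space_lift_unique_connected[OF cov _ _ _ _ _ conn(1) _ _ that])
      show "continuous_on (A \<inter> B) k" "continuous_on (A \<inter> B) l"
        using k(1) l(1) continuous_on_subset by blast+
      show "c \<in> A \<inter> B" using c by blast
    qed (use k l in auto)
    let ?m = "\<lambda>w. if w \<in> A then k w else l w"
    have "continuous_on (A \<union> B) ?m"
      by (rule continuous_on_cases[OF cl k(1) l(1)]) (use eq in auto)
    moreover have "?m \<in> A \<union> B \<rightarrow> C" "?m z = a" "\<forall>w\<in>A \<union> B. p (?m w) = f w"
      using k l za by auto
    ultimately show ?thesis by blast
  qed
  show ?thesis
    unfolding liftable_on_def
  proof (intro ballI impI)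
    fix z a assume z: "z \<in> A \<union> B" and a: "a \<in> C" "p a = f z"
    show "\<exists>k. continuous_on (A \<union> B) k \<and> k \<in> A \<union> B \<rightarrow> C \<and> k z = a \<and> (\<forall>w\<in>A \<union> B. p (k w) = f w)"
    proof (cases "z \<in> A")
      case True
      then show ?thesis by (rule half[OF A B assms(4,5) conn _ a])
    next
      case False
      then have "z \<in> B" using z by blast
      have "connected (B \<inter> A)" "B \<inter> A \<noteq> {}" using conn by (simp_all add: Int_commute)
      from half[OF B A assms(5,4) this \<open>z \<in> B\<close> a] show ?thesis by (simp only: Un_commute[of B])
    qed
  qed
qed

text \<open>
  Bisection in each coordinate separately: strips \<open>{a..b} \<times> {0..1}\<close> are glued along vertical
  edges, and a thin enough strip is glued from small rectangles along horizontal edges.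
\<close>
lemma liftable_on_unit_square:
  fixes f :: "real \<times> real \<Rightarrow> 'a::topological_space"
  assumes cov: "covering_space C p S"
    and f: "continuous_on ({0..1} \<times> {0..1}) f" "f \<in> {0..1} \<times> {0..1} \<rightarrow> S"
  shows "liftable_on C p ({0..1} \<times> {0..1}) f"
proof -
  \<comment> \<open>The guards are there because the local condition of \<open>Bolzano\<close>
    ranges over all short intervals around \<open>x\<close>, including those that leave
    \<open>{0..1}\<close>.\<close>
  let ?P = "\<lambda>a b. 0 \<le> a \<longrightarrow> b \<le> 1 \<longrightarrow> liftable_on C p ({a..b} \<times> {0..1}) f"
  have "?P 0 1"
  proof (rule Bolzano[of 0 1 ?P])
    fix a b c :: real assume *: "?P a b" "?P b c" "a \<le> b" "b \<le> c"
    show "?P a c"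
    proof (intro impI)
      assume ac: "0 \<le> a" "c \<le> 1"
      have un: "{a..b} \<times> {0..1} \<union> {b..c} \<times> {0..1} = {a..c} \<times> {0..1::real}"
        using * by auto
      have int: "{a..b} \<times> {0..1} \<inter> {b..c} \<times> {0..1} = {b} \<times> {0..1::real}"
        using * by auto
      have "liftable_on C p ({a..b} \<times> {0..1} \<union> {b..c} \<times> {0..1}) f"
        by (rule liftable_on_Un[OF cov])
          (use * ac in \<open>auto simp: int closed_Times intro: connected_Times\<close>)
      then show "liftable_on C p ({a..c} \<times> {0..1}) f" by (simp add: un)
    qed
  next
    fix x :: real assume x: "0 \<le> x" "x \<le> 1"
    \<comment> \<open>The admissible width \<open>e\<close> may depend on \<open>{c..d}\<close>, and
      gluing takes the minimum of two widths. This second bisection does the work of the tube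
      lemma.\<close>
    let ?Q = "\<lambda>c d. 0 \<le> c \<longrightarrow> d \<le> 1 \<longrightarrow> (\<exists>e>0. \<forall>a b. 0 \<le> a \<and> a \<le> x \<and> x \<le> b \<and> b \<le> 1 \<and> b - a < e
       \<longrightarrow> liftable_on C p ({a..b} \<times> {c..d}) f)"
    have "?Q 0 1"
    proof (rule Bolzano[of 0 1 ?Q])
      fix c d e :: real assume *: "?Q c d" "?Q d e" "c \<le> d" "d \<le> e"
      show "?Q c e"
      proof (intro impI)
        assume ce: "0 \<le> c" "e \<le> 1"
        have d: "0 \<le> d" "d \<le> 1" using * ce by auto
        from *(1) ce(1) d(2) obtain \<delta> where "\<delta> > 0"
          and \<delta>: "\<forall>a b. 0 \<le> a \<and> a \<le> x \<and> x \<le> b \<and> b \<le> 1 \<and> b - a < \<delta> \<longrightarrow> liftable_on C p ({a..b} \<times> {c..d}) f"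
          by (elim impE exE conjE)
        from *(2) d(1) ce(2) obtain \<epsilon> where "\<epsilon> > 0"
          and \<epsilon>: "\<forall>a b. 0 \<le> a \<and> a \<le> x \<and> x \<le> b \<and> b \<le> 1 \<and> b - a < \<epsilon> \<longrightarrow> liftable_on C p ({a..b} \<times> {d..e}) f"
          by (elim impE exE conjE)
        have "liftable_on C p ({a..b} \<times> {c..e}) f"
          if ab: "0 \<le> a \<and> a \<le> x \<and> x \<le> b \<and> b \<le> 1 \<and> b - a < min \<delta> \<epsilon>" for a b
        proof -
          have un: "{a..b} \<times> {c..d} \<union> {a..b} \<times> {d..e} = {a..b} \<times> {c..e}"
            using * by auto
          have int: "{a..b} \<times> {c..d} \<inter> {a..b} \<times> {d..e} = {a..b} \<times> {d}"
            using * by auto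
          have "liftable_on C p ({a..b} \<times> {c..d} \<union> {a..b} \<times> {d..e}) f"
            by (rule liftable_on_Un[OF cov])
              (use * ab \<delta> \<epsilon> in \<open>auto simp: int closed_Times intro: connected_Times\<close>)
          then show ?thesis by (simp add: un)
        qed
        then show "\<exists>e'>0. \<forall>a b. 0 \<le> a \<and> a \<le> x \<and> x \<le> b \<and> b \<le> 1 \<and> b - a < e'
            \<longrightarrow> liftable_on C p ({a..b} \<times> {c..e}) f"
          using \<open>\<delta> > 0\<close> \<open>\<epsilon> > 0\<close> by (intro exI[of _ "min \<delta> \<epsilon>"]) auto
      qed
    next
      fix y :: real assume y: "0 \<le> y" "y \<le> 1"
      have xy: "(x, y) \<in> {0..1} \<times> {0..1}" using x y by auto
      then have "f (x, y) \<in> S" using f(2) by blast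
      then obtain T where T: "f (x, y) \<in> T" "evenly_covered C p S T"
        using covering_space_evenly_coveredE[OF cov] by blast
      have "openin (top_of_set ({0..1} \<times> {0..1})) ({0..1} \<times> {0..1} \<inter> f -` T)"
        using continuous_openin_preimage[OF f evenly_covered_openin[OF T(2)]] .
      then obtain G where G: "open G" "{0..1} \<times> {0..1} \<inter> f -` T = ({0..1} \<times> {0..1}) \<inter> G"
        using openin_open by metis
      have "(x, y) \<in> G" using G xy T(1) by blast
      then obtain A B where AB: "open A" "open B" "x \<in> A" "y \<in> B" "A \<times> B \<subseteq> G"
        using open_prod_elim[OF G(1)] by (metis mem_Times_iff fst_conv snd_conv)
      obtain \<delta> where \<delta>: "\<delta> > 0" "ball x \<delta> \<subseteq> A" using AB open_contains_ball by metis
      obtain \<epsilon> where \<epsilon>: "\<epsilon> > 0" "ball y \<epsilon> \<subseteq> B" using AB open_contains_ball by metis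
      have small: "liftable_on C p ({a..b} \<times> {c..d}) f"
        if "0 \<le> a" "a \<le> x" "x \<le> b" "b \<le> 1" "b - a < \<delta>" "0 \<le> c" "c \<le> y" "y \<le> d" "d \<le> 1" "d - c < \<epsilon>"
        for a b c d
      proof (rule liftable_on_evenly_covered[OF T(2)])
        have sub: "{a..b} \<times> {c..d} \<subseteq> {0..1} \<times> {0..1}" using that by auto
        then show "continuous_on ({a..b} \<times> {c..d}) f" using f(1) continuous_on_subset by blast
        have "{a..b} \<subseteq> ball x \<delta>" "{c..d} \<subseteq> ball y \<epsilon>"
          using that by (auto simp: dist_real_def)
        then have "{a..b} \<times> {c..d} \<subseteq> G" using \<delta> \<epsilon> AB by blast
        then show "f \<in> {a..b} \<times> {c..d} \<rightarrow> T" using sub G(2) by blast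
      qed
      \<comment> \<open>Here \<open>\<epsilon>\<close> bounds the height of the rectangle, while
        \<open>\<delta>\<close> is the width that \<open>?Q\<close> asks for.\<close>
      show "\<exists>d>0. \<forall>a b. a \<le> y \<and> y \<le> b \<and> b - a < d \<longrightarrow> ?Q a b"
        using \<delta>(1) \<epsilon>(1) small by (intro exI[of _ \<epsilon>]) blast
    qed simp
    then obtain e where "e > 0" and e: "\<And>a b. 0 \<le> a \<and> a \<le> x \<and> x \<le> b \<and> b \<le> 1 \<and> b - a < e
       \<Longrightarrow> liftable_on C p ({a..b} \<times> {0..1}) f" by auto
    then show "\<exists>d>0. \<forall>a b. a \<le> x \<and> x \<le> b \<and> b - a < d \<longrightarrow> ?P a b"
      by blast
  qed simp
  then show ?thesis by simp
qed

subsection \<open>Lifts of paths\<close>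

text \<open>Agreement with \<open>g\<close> is asked on \<open>{0..1}\<close> only, since a path
  carries no information outside that interval.\<close>

definition path_lift ::
  "'a::topological_space set \<Rightarrow> ('a \<Rightarrow> 'b) \<Rightarrow> (real \<Rightarrow> 'b) \<Rightarrow> (real \<Rightarrow> 'a) \<Rightarrow> bool" where
  "path_lift C p g h \<longleftrightarrow> path h \<and> path_image h \<subseteq> C \<and> (\<forall>t\<in>{0..1}. p (h t) = g t)"

lemma path_lift_endpoints:
  assumes "path_lift C p g h"
  shows "p (pathstart h) = pathstart g" "p (pathfinish h) = pathfinish g"
    "pathstart h \<in> C" "pathfinish h \<in> C"
  using assms by (auto simp: path_lift_def pathstart_def pathfinish_def path_image_def)

lemma path_lift_self: "path h \<Longrightarrow> path_image h \<subseteq> C \<Longrightarrow> path_lift C p (p \<circ> h) h"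
  by (simp add: path_lift_def)

text \<open>The path is viewed as a map on the unit square that is constant in the first coordinate,
  so one lifting result serves both paths and homotopies.\<close>

lemma path_lift_exists:
  assumes cov: "covering_space C p S" and g: "path g" "path_image g \<subseteq> S"
    and a: "a \<in> C" "p a = pathstart g"
  obtains h where "path_lift C p g h" "pathstart h = a"
proof -
  let ?sq = "{0..1::real} \<times> {0..1::real}"
  have "continuous_on ?sq (g \<circ> snd)"
    using g(1) unfolding path_def
    by (intro continuous_on_compose continuous_intros) (auto elim: continuous_on_subset)
  moreover have "g \<circ> snd \<in> ?sq \<rightarrow> S"
    using g(2) by (auto simp: path_image_def)
  ultimately have "liftable_on C p ?sq (g \<circ> snd)"
    using liftable_on_unit_square[OF cov] by blast
  then obtain k where k: "continuous_on ?sq k" "k \<in> ?sq \<rightarrow> C" "k (0, 0) = a"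
      "\<And>w. w \<in> ?sq \<Longrightarrow> p (k w) = (g \<circ> snd) w"
    using liftable_onE[of C p ?sq "g \<circ> snd" "(0, 0)" a] a by (auto simp: pathstart_def)
  show ?thesis
  proof (rule that)
    have "continuous_on {0..1} (\<lambda>t. k (0, t))"
      by (rule continuous_on_compose2[OF k(1)]) (auto intro!: continuous_intros)
    then show "path_lift C p g (\<lambda>t. k (0, t))"
      using k by (auto simp: path_lift_def path_def path_image_def)
    show "pathstart (\<lambda>t. k (0, t)) = a"
      using k by (simp add: pathstart_def)
  qed
qed

lemma path_lift_unique:
  assumes cov: "covering_space C p S" and h: "path_lift C p g h" "path_lift C p g k"
    and eq: "pathstart h = pathstart k" and t: "t \<in> {0..1}"
  shows "h t = k t"
  by (rule covering_space_lift_unique_connected[OF cov, of "{0..1}" h k 0])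
    (use h eq t in \<open>auto simp: path_lift_def path_def path_image_def pathstart_def\<close>)

lemma path_lift_unique_finish:
  assumes "covering_space C p S" "path_lift C p g h" "path_lift C p g k" "pathstart h = pathstart k"
  shows "pathfinish h = pathfinish k"
  using path_lift_unique[OF assms, of 1] by (simp add: pathfinish_def)

text \<open>The homotopy is lifted to a map \<open>K\<close> on the square. Its edges over the fixed
  endpoints are constant, so its first and last rows are lifts of \<open>g\<close> and
  \<open>g'\<close> with the same start and the same end.\<close>

lemma path_lift_monodromy:
  assumes cov: "covering_space C p S" and hom: "homotopic_paths S g g'"
    and h: "path_lift C p g h" "path_lift C p g' h'" and eq: "pathstart h = pathstart h'"
  shows "pathfinish h = pathfinish h'"
proof -
  let ?sq = "{0..1::real} \<times> {0..1::real}"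
  obtain H where H: "continuous_on ?sq H" "H \<in> ?sq \<rightarrow> S"
      "\<And>x. x \<in> {0..1} \<Longrightarrow> H (0, x) = g x" "\<And>x. x \<in> {0..1} \<Longrightarrow> H (1, x) = g' x"
      "\<And>t. t \<in> {0..1} \<Longrightarrow> H (t, 0) = pathstart g" "\<And>t. t \<in> {0..1} \<Longrightarrow> H (t, 1) = pathfinish g"
    using hom unfolding homotopic_paths by (auto simp: pathstart_def pathfinish_def)
  have "liftable_on C p ?sq H"
    using liftable_on_unit_square[OF cov H(1,2)] .
  moreover have "pathstart h \<in> C" "p (pathstart h) = H (0, 0)"
    using path_lift_endpoints[OF h(1)] H(5)[of 0] by auto
  ultimately obtain K where K: "continuous_on ?sq K" "K \<in> ?sq \<rightarrow> C" "K (0, 0) = pathstart h"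
      "\<And>w. w \<in> ?sq \<Longrightarrow> p (K w) = H w"
    using liftable_onE[of C p ?sq H "(0, 0)" "pathstart h"] by auto
  have row: "path_lift C p g'' (\<lambda>t. K (x, t))"
    if "x \<in> {0..1}" "\<And>t. t \<in> {0..1} \<Longrightarrow> H (x, t) = g'' t" for x g''
  proof -
    have "continuous_on {0..1} (\<lambda>t. K (x, t))"
      by (rule continuous_on_compose2[OF K(1)]) (use that in \<open>auto intro!: continuous_intros\<close>)
    then show ?thesis
      using K that by (auto simp: path_lift_def path_def path_image_def)
  qed
  \<comment> \<open>Such an edge and the constant path at its first point both lift a constant path,
    so uniqueness identifies them.\<close>
  have col: "K (t, y) = K (0, y)"
    if "y \<in> {0..1}" "\<And>t. t \<in> {0..1} \<Longrightarrow> H (t, y) = c" "t \<in> {0..1}" for t y c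
  proof (rule path_lift_unique[OF cov, of "\<lambda>_. c" "\<lambda>t. K (t, y)" "\<lambda>_. K (0, y)"])
    have "continuous_on {0..1} (\<lambda>t. K (t, y))"
      by (rule continuous_on_compose2[OF K(1)]) (use that in \<open>auto intro!: continuous_intros\<close>)
    then show "path_lift C p (\<lambda>_. c) (\<lambda>t. K (t, y))"
      using K that by (auto simp: path_lift_def path_def path_image_def)
    show "path_lift C p (\<lambda>_. c) (\<lambda>_. K (0, y))"
      using K that by (auto simp: path_lift_def path_def path_image_def)
  qed (use that(3) in \<open>simp_all add: pathstart_def\<close>)
  have "pathfinish h = K (0, 1)"
    using path_lift_unique[OF cov h(1) row[of 0 g], of 1] H K(3) by (simp add: pathstart_def pathfinish_def)
  also have "\<dots> = K (1, 1)"
    using col[of 1 "pathfinish g" 1] H(6) by simp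
  also have "\<dots> = pathfinish h'"
  proof -
    have "K (1, 0) = pathstart h'"
      using col[of 0 "pathstart g" 1] H(5) K(3) eq by simp
    then show ?thesis
      using path_lift_unique[OF cov h(2) row[of 1 g'], of 1] H(4) by (simp add: pathstart_def pathfinish_def)
  qed
  finally show ?thesis .
qed

section \<open>Lifts of concatenated and reversed paths\<close>

lemma path_lift_join:
  assumes h: "path_lift C p g1 h1" "path_lift C p g2 h2" and eq: "pathfinish h1 = pathstart h2"
  shows "path_lift C p (g1 +++ g2) (h1 +++ h2)"
  using assms unfolding path_lift_def
  by (auto simp: path_image_join) (auto simp: joinpaths_def)

lemma path_lift_reversepath:
  assumes "path_lift C p g h"
  shows "path_lift C p (reversepath g) (reversepath h)"
  using assms unfolding path_lift_def by simp (simp add: reversepath_def)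

lemma path_lift_joinE:
  assumes h: "path_lift C p (g1 +++ g2) h" and eq: "pathfinish g1 = pathstart g2"
  obtains h1 h2 where "path_lift C p g1 h1" "path_lift C p g2 h2" "pathstart h1 = pathstart h"
    "pathfinish h1 = pathstart h2" "pathfinish h2 = pathfinish h"
proof (rule that)
  have H: "continuous_on {0..1} h" "h ` {0..1} \<subseteq> C" and ph: "\<And>t. t \<in> {0..1} \<Longrightarrow> p (h t) = (g1 +++ g2) t"
    using h by (auto simp: path_lift_def path_def path_image_def)
  show "path_lift C p g1 (\<lambda>t. h (t/2))"
    unfolding path_lift_def
  proof (intro conjI ballI)
    show "path (\<lambda>t. h (t/2))"
      unfolding path_def by (rule continuous_on_compose2[OF H(1)]) (auto intro!: continuous_intros)
    show "path_image (\<lambda>t. h (t/2)) \<subseteq> C"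
      using H(2) by (auto simp: path_image_def)
    fix t :: real assume "t \<in> {0..1}"
    then show "p (h (t/2)) = g1 t"
      using ph[of "t/2"] by (simp add: joinpaths_def)
  qed
  show "path_lift C p g2 (\<lambda>t. h ((t + 1)/2))"
    unfolding path_lift_def
  proof (intro conjI ballI)
    show "path (\<lambda>t. h ((t + 1)/2))"
      unfolding path_def by (rule continuous_on_compose2[OF H(1)]) (auto intro!: continuous_intros)
    show "path_image (\<lambda>t. h ((t + 1)/2)) \<subseteq> C"
      using H(2) by (auto simp: path_image_def)
    fix t :: real assume t: "t \<in> {0..1}"
    \<comment> \<open>At \<open>t = 0\<close> the join is evaluated at its midpoint, where it
      follows \<open>g1\<close>; there \<open>eq\<close> is what gives the value of
      \<open>g2\<close>.\<close>
    have "(g1 +++ g2) ((t + 1)/2) = g2 t"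
      using t eq by (auto simp: joinpaths_def pathstart_def pathfinish_def field_simps)
    then show "p (h ((t + 1)/2)) = g2 t"
      using t ph[of "(t + 1)/2"] by simp
  qed
qed (auto simp: pathstart_def pathfinish_def)

subsection \<open>Spanier loops lift to loops\<close>

text \<open>Inside the sheet through the start of \<open>h\<close>, the inverse of \<open>p\<close>
  turns the loop \<open>v\<close> into a closed lift, and by uniqueness \<open>h\<close> follows
  it.\<close>

lemma path_lift_evenly_covered_loop:
  assumes cov: "covering_space C p S" and T: "evenly_covered C p S T"
    and v: "v \<in> loops_at T x" and h: "path_lift C p v h"
  shows "pathfinish h = pathstart h"
proof -
  have v: "path v" "path_image v \<subseteq> T" "pathstart v = pathfinish v"
    using v by (auto simp: loops_at_def)
  have "pathstart h \<in> C" "p (pathstart h) = pathstart v"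
    using path_lift_endpoints[OF h] by auto
  moreover have "pathstart v \<in> T" using v by auto
  ultimately obtain u s where u: "pathstart h \<in> u" "openin (top_of_set C) u" "homeomorphism u T p s"
    using evenly_covered_sheetE[OF T] by metis
  have "path (s \<circ> v)"
    using v u(3) by (metis continuous_on_subset homeomorphism_def path_continuous_image)
  moreover have "path_image (s \<circ> v) \<subseteq> C"
    using v(2) homeomorphism_image2[OF u(3)] openin_imp_subset[OF u(2)]
    by (fastforce simp: path_image_compose)
  moreover have "p ((s \<circ> v) t) = v t" if "t \<in> {0..1}" for t
  proof -
    have "v t \<in> T" using v(2) that by (auto simp: path_image_def)
    then show ?thesis using homeomorphism_apply2[OF u(3)] by simp
  qed
  ultimately have l: "path_lift C p v (s \<circ> v)" by (simp add: path_lift_def)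
  have st: "pathstart h = pathstart (s \<circ> v)"
    using \<open>p (pathstart h) = pathstart v\<close> homeomorphism_apply1[OF u(3,1)] by (simp add: pathstart_compose)
  have "pathfinish h = pathfinish (s \<circ> v)"
    by (rule path_lift_unique_finish[OF cov h l st])
  also have "\<dots> = pathstart (s \<circ> v)"
    using v(3) by (simp add: pathstart_compose pathfinish_compose)
  finally show ?thesis using st by simp
qed

text \<open>A lift of one factor runs along a lift of \<open>u\<close>, then around a closed lift of
  \<open>v\<close>, then back along the lift of \<open>u\<close>, so it is closed; induction over
  the list does the rest. The map \<open>f\<close> enters because the product is formed in its
  source, and only images under \<open>f\<close> are lifted.\<close>

lemma path_lift_conj_product:
  fixes f :: "'d::topological_space \<Rightarrow> 'b::topological_space"
  assumes cov: "covering_space C p S"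
    and uvs: "\<And>u v. (u, v) \<in> set uvs \<Longrightarrow> pathstart u = x \<and>
       (\<exists>T. evenly_covered C p S T \<and> f \<circ> v \<in> loops_at T (f (pathfinish u)) \<and>
            pathstart v = pathfinish u \<and> pathfinish v = pathfinish u)"
    and h: "path_lift C p (f \<circ> conj_product x uvs) h"
  shows "pathfinish h = pathstart h"
  using uvs h
proof (induction uvs arbitrary: h)
  case Nil
  then have h: "path_lift C p (\<lambda>_. f x) h" by (simp add: conj_product_def comp_def)
  then have "path_lift C p (\<lambda>_. f x) (\<lambda>_. pathstart h)"
    using path_lift_endpoints[OF h] by (auto simp: path_lift_def path_def path_image_def pathstart_def)
  from path_lift_unique_finish[OF cov h this] show ?case by (simp add: pathstart_def pathfinish_def)
next
  case (Cons uv uvs)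
  obtain u v where [simp]: "uv = (u, v)" by (cases uv)
  have uv: "(u, v) \<in> set (uv # uvs)" by simp
  obtain T where u: "pathstart u = x" and v: "pathstart v = pathfinish u" "pathfinish v = pathfinish u"
    and T: "evenly_covered C p S T" "f \<circ> v \<in> loops_at T (f (pathfinish u))"
    using Cons.prems(1)[OF uv] by blast
  let ?g = "conj_product x uvs"
  have pg: "pathstart ?g = x"
  proof (cases uvs)
    case Nil
    then show ?thesis by (simp add: conj_product_def pathstart_def)
  next
    case (Cons uv' uvs')
    obtain u' v' where "uv' = (u', v')" by (cases uv')
    then show ?thesis using Cons.prems(1)[of u' v'] Cons by (simp add: conj_product_def)
  qed
  have "path_lift C p (((f \<circ> u) +++ (f \<circ> v) +++ reversepath (f \<circ> u)) +++ (f \<circ> ?g)) h"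
    using Cons.prems(2) by (simp add: conj_product_def path_compose_join path_compose_reversepath)
  then obtain h' k where h': "path_lift C p ((f \<circ> u) +++ (f \<circ> v) +++ reversepath (f \<circ> u)) h'"
      and k: "path_lift C p (f \<circ> ?g) k"
      and ends: "pathstart h' = pathstart h" "pathfinish h' = pathstart k" "pathfinish k = pathfinish h"
    by (rule path_lift_joinE) (use u pg in \<open>auto simp: pathstart_compose\<close>)
  obtain h1 h'' where h1: "path_lift C p (f \<circ> u) h1"
      and h'': "path_lift C p ((f \<circ> v) +++ reversepath (f \<circ> u)) h''"
      and ends': "pathstart h1 = pathstart h'" "pathfinish h1 = pathstart h''" "pathfinish h'' = pathfinish h'"
    using h' by (rule path_lift_joinE) (use v in \<open>auto simp: pathstart_compose pathfinish_compose\<close>)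
  obtain h2 h3 where h2: "path_lift C p (f \<circ> v) h2" and h3: "path_lift C p (reversepath (f \<circ> u)) h3"
      and ends'': "pathstart h2 = pathstart h''" "pathfinish h2 = pathstart h3" "pathfinish h3 = pathfinish h''"
    using h'' by (rule path_lift_joinE) (use v in \<open>auto simp: pathfinish_compose\<close>)
  have "pathfinish h2 = pathstart h2"
    by (rule path_lift_evenly_covered_loop[OF cov T h2])
  \<comment> \<open>Since \<open>h2\<close> is closed, \<open>h3\<close> starts where
    \<open>h1\<close> ends and therefore retraces it.\<close>
  then have "pathfinish h3 = pathfinish (reversepath h1)"
    using ends' ends'' by (intro path_lift_unique_finish[OF cov h3 path_lift_reversepath[OF h1]]) simp
  moreover have "pathfinish k = pathstart k"
    by (rule Cons.IH[OF Cons.prems(1) k]) simp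
  ultimately show ?case using ends ends' ends'' by simp
qed

text \<open>The key use of the Spanier condition. The loop formed from \<open>g\<close> and the
  reverse of \<open>g'\<close> is homotopic to a product of small conjugates, whose image lifts to a
  closed path. By monodromy the image of the loop lifts to a closed path too, so the two lifts end
  at the same point.\<close>

lemma spanier_lift_endpoint_unique:
  assumes cov: "covering_space C p S" and f: "continuous_on Z f" "f \<in> Z \<rightarrow> S"
    and spanier: "fundamental_group Z z = spanier_group Z z"
    and g: "path g" "path_image g \<subseteq> Z" "pathstart g = z"
    and g': "path g'" "path_image g' \<subseteq> Z" "pathstart g' = z" "pathfinish g' = pathfinish g"
    and h: "path_lift C p (f \<circ> g) h" and h': "path_lift C p (f \<circ> g') h'"
    and eq: "pathstart h = pathstart h'"
  shows "pathfinish h = pathfinish h'"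
proof -
  \<comment> \<open>The cover is pulled back along \<open>f\<close>, so that a loop in one of its
    members is sent by \<open>f\<close> into an evenly covered set.\<close>
  let ?l = "g +++ reversepath g'" and ?U = "(\<lambda>T. Z \<inter> f -` T) ` {T. evenly_covered C p S T}"
  have l: "?l \<in> loops_at Z z"
    using g g' by (auto simp: loops_at_def path_image_join)
  have fgi: "path (f \<circ> k)" "path_image (f \<circ> k) \<subseteq> S" if "path k" "path_image k \<subseteq> Z" for k
    using that f path_continuous_image continuous_on_subset
    by (blast, fastforce simp: path_image_compose)
  have "x \<in> \<Union>?U" if x: "x \<in> Z" for x
  proof -
    obtain T where "f x \<in> T" "evenly_covered C p S T"
      using covering_space_evenly_coveredE[OF cov, of "f x"] f(2) x by blast
    then show ?thesis using x by (intro UnionI[of "Z \<inter> f -` T"]) auto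
  qed
  moreover have "openin (top_of_set Z) U" if "U \<in> ?U" for U
    using that continuous_openin_preimage[OF f evenly_covered_openin] by (elim imageE CollectE) simp
  ultimately have "open_cover ?U Z"
    unfolding open_cover_def by (intro conjI ballI equalityI subsetI) (assumption | simp | blast)+
  moreover have "path_class Z ?l \<in> spanier_group Z z"
    using l spanier by (auto simp: fundamental_group_def)
  ultimately have "path_class Z ?l \<in> spanier_group_cover Z ?U z"
    by (auto simp: spanier_group_def)
  then obtain uvs where uvs: "path_class Z ?l = path_class Z (conj_product z uvs)"
      "\<forall>(u, v) \<in> set uvs. path u \<and> path_image u \<subseteq> Z \<and> pathstart u = z \<and>
          (\<exists>U\<in>?U. v \<in> loops_at U (pathfinish u))"
    unfolding spanier_group_cover_def by (elim CollectE exE conjE)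
  \<comment> \<open>Equality of classes yields a homotopy because \<open>?l\<close>, being a path in
    \<open>Z\<close>, belongs to its own class.\<close>
  have "?l \<in> path_class Z ?l"
    using l by (simp add: path_class_def loops_at_def)
  then have "?l \<in> path_class Z (conj_product z uvs)" unfolding uvs(1) .
  then have "homotopic_paths Z (conj_product z uvs) ?l"
    unfolding path_class_def by (rule CollectD)
  then have hom: "homotopic_paths Z ?l (conj_product z uvs)"
    by (rule homotopic_paths_sym)
  then have fhom: "homotopic_paths S (f \<circ> ?l) (f \<circ> conj_product z uvs)"
    using homotopic_paths_continuous_image f by blast
  have p0: "pathstart h \<in> C" "p (pathstart h) = f z"
    using path_lift_endpoints[OF h] g(3) by (auto simp: pathstart_compose)
  obtain c where c: "path_lift C p (f \<circ> conj_product z uvs) c" "pathstart c = pathstart h"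
  proof (rule path_lift_exists[OF cov _ _ p0(1)])
    show "path (f \<circ> conj_product z uvs)" "path_image (f \<circ> conj_product z uvs) \<subseteq> S"
      using fhom homotopic_paths_imp_path homotopic_paths_imp_subset by blast+
    show "p (pathstart h) = pathstart (f \<circ> conj_product z uvs)"
      using p0 homotopic_paths_imp_pathstart[OF hom] g by (simp add: pathstart_compose)
  qed
  have closed: "pathfinish c = pathstart c"
  proof (rule path_lift_conj_product[OF cov _ c(1)])
    fix u v assume "(u, v) \<in> set uvs"
    then obtain T where T: "evenly_covered C p S T" "v \<in> loops_at (Z \<inter> f -` T) (pathfinish u)"
        "pathstart u = z"
      using uvs(2) by fastforce
    then have "path (f \<circ> v)"
      using fgi(1)[of v] by (simp add: loops_at_def)
    then have "f \<circ> v \<in> loops_at T (f (pathfinish u))"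
      using T by (auto simp: loops_at_def pathstart_compose pathfinish_compose path_image_compose)
    then show "pathstart u = z \<and> (\<exists>T. evenly_covered C p S T \<and> f \<circ> v \<in> loops_at T (f (pathfinish u)) \<and>
            pathstart v = pathfinish u \<and> pathfinish v = pathfinish u)"
      using T by (auto simp: loops_at_def)
  qed
  \<comment> \<open>The return path is lifted from the end of \<open>h\<close>, so that
    \<open>h +++ k\<close> lifts the image of the whole loop. Once that lift is known to be closed,
    the reverse of \<open>k\<close> is a lift of \<open>f \<circ> g'\<close> with the same start as
    \<open>h'\<close>.\<close>
  obtain k where k: "path_lift C p (f \<circ> reversepath g') k" "pathstart k = pathfinish h"
  proof (rule path_lift_exists[OF cov])
    show "path (f \<circ> reversepath g')" "path_image (f \<circ> reversepath g') \<subseteq> S"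
      using fgi[of "reversepath g'"] g' by auto
    show "pathfinish h \<in> C" "p (pathfinish h) = pathstart (f \<circ> reversepath g')"
      using path_lift_endpoints[OF h] g' by (auto simp: pathstart_compose pathfinish_compose)
  qed
  have "path_lift C p (f \<circ> ?l) (h +++ k)"
    using path_lift_join[OF h k(1)] k(2) by (simp add: path_compose_join)
  from path_lift_monodromy[OF cov fhom this c(1)] have "pathfinish k = pathstart h"
    using closed c(2) by simp
  moreover have "path_lift C p (f \<circ> g') (reversepath k)"
    using path_lift_reversepath[OF k(1)] by (simp add: path_compose_reversepath)
  ultimately have "pathfinish (reversepath k) = pathfinish h'"
    using eq by (intro path_lift_unique_finish[OF cov _ h']) simp_all
  then show ?thesis using k(2) by simp
qed

subsection \<open>Lifting along coverings and factorization\<close>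

text \<open>A sheet is open and homeomorphic to an open subset of \<open>S\<close>, so small path
  connected neighbourhoods can be pulled back into it.\<close>

lemma covering_space_locally_path_connected_domain:
  assumes cov: "covering_space C p S" and S: "locally path_connected S"
  shows "locally path_connected C"
  unfolding locally_path_connected
proof (intro allI impI)
  fix V z assume "openin (top_of_set C) V \<and> z \<in> V"
  then have V: "openin (top_of_set C) V" "z \<in> V" by auto
  then have z: "z \<in> C" using openin_imp_subset by blast
  then have "p z \<in> S" using covering_space_funcset[OF cov] by blast
  then obtain T where T: "p z \<in> T" "evenly_covered C p S T"
    using covering_space_evenly_coveredE[OF cov] by blast
  then obtain u s where u: "z \<in> u" "openin (top_of_set C) u" "homeomorphism u T p s"
    using evenly_covered_sheetE[OF T(2) z] by metis
  have "openin (top_of_set u) (u \<inter> V)"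
    using V(1) u(2) by (metis openin_Int openin_imp_subset openin_subset_trans inf_le1)
  then have "openin (top_of_set T) (p ` (u \<inter> V))"
    using homeomorphism_imp_open_map[OF u(3)] by blast
  then have "openin (top_of_set S) (p ` (u \<inter> V))"
    using evenly_covered_openin[OF T(2)] openin_trans by blast
  then obtain W where W: "openin (top_of_set S) W" "path_connected W" "p z \<in> W" "W \<subseteq> p ` (u \<inter> V)"
    using S u(1) V(2) unfolding locally_path_connected by (metis IntI imageI)
  have WT: "W \<subseteq> T"
    using W(4) u(3) unfolding homeomorphism_def by blast
  have hom: "homeomorphism (u \<inter> p -` W) W p s"
    using homeomorphism_restrict_preimage[OF u(3) WT] .
  have "openin (top_of_set C) (u \<inter> (C \<inter> p -` W))"
    using u(2) continuous_openin_preimage[OF covering_space_imp_continuous[OF cov] covering_space_funcset[OF cov] W(1)]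
    by (rule openin_Int)
  then have "openin (top_of_set C) (u \<inter> p -` W)"
    using openin_imp_subset[OF u(2)] by (metis inf.absorb1 inf_assoc)
  moreover have "path_connected (u \<inter> p -` W)"
    using hom W(2) homeomorphism_def path_connected_continuous_image by metis
  moreover have "u \<inter> p -` W \<subseteq> V"
  proof
    fix w assume w: "w \<in> u \<inter> p -` W"
    then obtain w' where "w' \<in> u \<inter> V" "p w = p w'" using W(4) by blast
    then have "w = w'"
      using w homeomorphism_apply1[OF u(3)] by (metis IntD1)
    then show "w \<in> V" using \<open>w' \<in> u \<inter> V\<close> by blast
  qed
  ultimately show "\<exists>U. openin (top_of_set C) U \<and> path_connected U \<and> z \<in> U \<and> U \<subseteq> V"
    using u(1) W(3) by (intro exI[of _ "u \<inter> p -` W"]) auto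
qed

text \<open>A lifting criterion in which the Spanier condition on \<open>Z\<close> replaces the
  usual inclusion of images of fundamental groups. It is what makes the endpoint of a lifted path
  independent of the path.\<close>

lemma covering_space_lift_spanier:
  assumes cov: "covering_space C p S" and Z: "path_connected Z" "locally path_connected Z"
    and f: "continuous_on Z f" "f \<in> Z \<rightarrow> S"
    and z0: "z0 \<in> Z" and a: "a \<in> C" "p a = f z0"
    and spanier: "fundamental_group Z z0 = spanier_group Z z0"
  obtains r where "continuous_on Z r" "r \<in> Z \<rightarrow> C" "\<And>z. z \<in> Z \<Longrightarrow> p (r z) = f z"
proof -
  \<comment> \<open>The graph of the future lift: \<open>y\<close> is the end of the lift, started
    at \<open>a\<close>, of the image of some path from \<open>z0\<close> to
    \<open>z\<close>.\<close>
  define R where "R z y \<longleftrightarrow> (\<exists>g h. path g \<and> path_image g \<subseteq> Z \<and> pathstart g = z0 \<and> pathfinish g = z \<and>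
     path_lift C p (f \<circ> g) h \<and> pathstart h = a \<and> pathfinish h = y)" for z y
  have ex: "\<exists>y. R z y" if z: "z \<in> Z" for z
  proof -
    obtain g where g: "path g" "path_image g \<subseteq> Z" "pathstart g = z0" "pathfinish g = z"
      using Z(1) z0 z unfolding path_connected_def by blast
    have "path (f \<circ> g)" "path_image (f \<circ> g) \<subseteq> S"
      using g f path_continuous_image continuous_on_subset
      by (blast, fastforce simp: path_image_compose)
    then obtain h where "path_lift C p (f \<circ> g) h" "pathstart h = a"
      using path_lift_exists[OF cov _ _ a(1)] a(2) g(3) by (metis pathstart_compose)
    then show ?thesis unfolding R_def using g by blast
  qed
  have uniq: "y = y'" if "R z y" "R z y'" for z y y'
    using that unfolding R_def
    by (elim exE conjE) (metis spanier_lift_endpoint_unique[OF cov f spanier])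
  have Rp: "y \<in> C" "p y = f z" if "R z y" for z y
    using that path_lift_endpoints unfolding R_def by (fastforce simp: pathfinish_compose)+
  obtain r where r: "\<And>z. z \<in> Z \<Longrightarrow> R z (r z)" using ex by metis
  show ?thesis
  proof (rule that)
    show "r \<in> Z \<rightarrow> C" "\<And>z. z \<in> Z \<Longrightarrow> p (r z) = f z" using r Rp by blast+
    show "continuous_on Z r"
      unfolding continuous_on_def
    proof
      fix z assume z: "z \<in> Z"
      then have "f z \<in> S" using f by blast
      then obtain T where T: "f z \<in> T" "evenly_covered C p S T"
        using covering_space_evenly_coveredE[OF cov] by blast
      have "p (r z) = f z" "r z \<in> C" using r[OF z] Rp by auto
      then obtain u s where u: "r z \<in> u" "openin (top_of_set C) u" "homeomorphism u T p s"
        using evenly_covered_sheetE[OF T(2)] T(1) by metis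
      have uC: "u \<subseteq> C" using openin_imp_subset[OF u(2)] .
      have "openin (top_of_set Z) (Z \<inter> f -` T)" "z \<in> Z \<inter> f -` T"
        using continuous_openin_preimage[OF f evenly_covered_openin[OF T(2)]] z T(1) by auto
      then obtain W where W: "openin (top_of_set Z) W" "path_connected W" "z \<in> W" "W \<subseteq> Z \<inter> f -` T"
        using Z(2) unfolding locally_path_connected by metis
      have s: "continuous_on T s" "s ` T = u" using u(3) by (auto simp: homeomorphism_def)
      have contf: "continuous_on W f" using f(1) W(4) continuous_on_subset by blast
      \<comment> \<open>A path to \<open>z\<close> is prolonged to \<open>w\<close> inside
        \<open>W\<close>. The added piece lifts within the sheet \<open>u\<close>, by way of
        \<open>s\<close>, and ends at \<open>s (f w)\<close>; single-valuedness of \<open>R\<close>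
        then identifies this point with \<open>r w\<close>.\<close>
      have eq: "r w = (s \<circ> f) w" if w: "w \<in> W" for w
      proof (rule uniq[OF r])
        show "w \<in> Z" using w W by blast
        obtain g h where gh: "path g" "path_image g \<subseteq> Z" "pathstart g = z0" "pathfinish g = z"
            "path_lift C p (f \<circ> g) h" "pathstart h = a" "pathfinish h = r z"
          using r[OF z] unfolding R_def by blast
        obtain k where k: "path k" "path_image k \<subseteq> W" "pathstart k = z" "pathfinish k = w"
          using W(2,3) w unfolding path_connected_def by blast
        have fk: "path (f \<circ> k)" "path_image (f \<circ> k) \<subseteq> T"
          using k W(4) path_continuous_image continuous_on_subset[OF contf]
          by (blast, fastforce simp: path_image_compose)
        have "path_lift C p (f \<circ> k) (s \<circ> (f \<circ> k))"
          unfolding path_lift_def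
        proof (intro conjI ballI)
          show "path (s \<circ> (f \<circ> k))"
            using fk s(1) path_continuous_image continuous_on_subset by blast
          show "path_image (s \<circ> (f \<circ> k)) \<subseteq> C"
            using fk(2) s(2) uC by (auto simp: path_image_compose)
          fix t :: real assume "t \<in> {0..1}"
          then have "(f \<circ> k) t \<in> T" using fk(2) by (auto simp: path_image_def)
          then show "p ((s \<circ> (f \<circ> k)) t) = (f \<circ> k) t"
            using homeomorphism_apply2[OF u(3)] by simp
        qed
        moreover have "s (f z) = r z"
          using homeomorphism_apply1[OF u(3,1)] \<open>p (r z) = f z\<close> by simp
        ultimately have "path_lift C p (f \<circ> (g +++ k)) (h +++ (s \<circ> (f \<circ> k)))"
          using path_lift_join[OF gh(5)] gh k by (simp add: path_compose_join pathstart_compose)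
        moreover have "path (g +++ k)" "path_image (g +++ k) \<subseteq> Z"
          using gh k W(4) by (auto simp: path_image_join)
        ultimately show "R w ((s \<circ> f) w)"
          unfolding R_def using gh k
          by (intro exI[of _ "g +++ k"] exI[of _ "h +++ (s \<circ> (f \<circ> k))"]) (simp add: pathfinish_compose)
      qed
      have "continuous_on W (s \<circ> f)"
        using contf W(4) s(1) by (intro continuous_on_compose) (auto elim: continuous_on_subset)
      then have "continuous_on W r" using eq continuous_on_cong by (metis (no_types, lifting))
      then have "(r \<longlongrightarrow> r z) (at z within W)"
        using W(3) by (simp add: continuous_on_def)
      moreover obtain G where "open G" "W = Z \<inter> G" using W(1) openin_open by metis
      then have "at z within Z = at z within W"
        using W(3) by (intro at_within_nhd[of z G]) auto
      ultimately show "(r \<longlongrightarrow> r z) (at z within Z)" by simp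
    qed
  qed
qed

section \<open>Maps between coverings are coverings\<close>

text \<open>Over a path connected set evenly covered by both \<open>p\<close> and \<open>q\<close>,
  the sheets of \<open>p\<close> are connected, so \<open>r\<close> sends each of them into a single
  sheet of \<open>q\<close>, and homeomorphically onto it.\<close>

lemma covering_space_factor:
  assumes p: "covering_space Z p X" and q: "covering_space Y q X"
    and X: "locally path_connected X" and Y: "path_connected Y" and Z: "Z \<noteq> {}"
    and r: "continuous_on Z r" "r \<in> Z \<rightarrow> Y" "\<And>z. z \<in> Z \<Longrightarrow> q (r z) = p z"
  shows "covering_space Z r Y"
  unfolding covering_space_iff_evenly_covered
proof (intro conjI ballI)
  show "continuous_on Z r" by fact
  \<comment> \<open>To reach \<open>y\<close>, a path from \<open>r z\<close> to \<open>y\<close> is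
    pushed down by \<open>q\<close> and lifted along \<open>p\<close> from \<open>z\<close>.
    Applying \<open>r\<close> gives a lift along \<open>q\<close> that must be the original
    path.\<close>
  show "r ` Z = Y"
  proof
    show "r ` Z \<subseteq> Y" using r by blast
    show "Y \<subseteq> r ` Z"
    proof
      fix y assume y: "y \<in> Y"
      obtain z where z: "z \<in> Z" using Z by blast
      then have "r z \<in> Y" using r by blast
      then obtain h where h: "path h" "path_image h \<subseteq> Y" "pathstart h = r z" "pathfinish h = y"
        using Y y unfolding path_connected_def by blast
      have "path (q \<circ> h)" "path_image (q \<circ> h) \<subseteq> X"
        using h path_continuous_image continuous_on_subset[OF covering_space_imp_continuous[OF q]]
          covering_space_funcset[OF q]
        by (blast, fastforce simp: path_image_compose)
      then obtain g where g: "path_lift Z p (q \<circ> h) g" "pathstart g = z"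
        using path_lift_exists[OF p _ _ z] r(3)[OF z] h(3) by (metis pathstart_compose)
      have gi: "path g" "path_image g \<subseteq> Z" using g by (auto simp: path_lift_def)
      have "path_lift Y q (q \<circ> h) (r \<circ> g)"
        unfolding path_lift_def
      proof (intro conjI ballI)
        show "path (r \<circ> g)" using gi r(1) path_continuous_image continuous_on_subset by blast
        show "path_image (r \<circ> g) \<subseteq> Y" using gi r(2) by (auto simp: path_image_compose)
        fix t :: real assume t: "t \<in> {0..1}"
        then have "g t \<in> Z" using gi by (auto simp: path_image_def)
        then show "q ((r \<circ> g) t) = (q \<circ> h) t" using r(3) g(1) t by (simp add: path_lift_def)
      qed
      then have "pathfinish (r \<circ> g) = pathfinish h"
        using path_lift_unique_finish[OF q _ path_lift_self[OF h(1,2)]] g h by (simp add: pathstart_compose)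
      then show "y \<in> r ` Z"
        using h(4) path_lift_endpoints(4)[OF g(1)] by (auto simp: pathfinish_compose)
    qed
  qed
  fix y assume y: "y \<in> Y"
  then have "q y \<in> X" using covering_space_funcset[OF q] by blast
  then obtain T where T: "q y \<in> T" "evenly_covered Y q X T"
    using covering_space_evenly_coveredE[OF q] by blast
  obtain W where W: "q y \<in> W" "W \<subseteq> T" "path_connected W" "evenly_covered Z p X W"
    using covering_space_locally_path_connected_nhd[OF p X evenly_covered_openin[OF T(2)] T(1)] by blast
  have eW: "evenly_covered Y q X W"
    using evenly_covered_subset[OF T(2) W(2) evenly_covered_openin[OF W(4)]
        covering_space_imp_continuous[OF q] covering_space_funcset[OF q]] .
  then obtain V s where V: "y \<in> V" "openin (top_of_set Y) V" "homeomorphism V W q s"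
    using evenly_covered_sheetE[OF eW y W(1)] by metis
  have s: "continuous_on W s" "s ` W = V" using V(3) by (auto simp: homeomorphism_def)
  obtain \<V> where \<V>: "\<Union>\<V> = Z \<inter> p -` W" "\<And>u. u \<in> \<V> \<Longrightarrow> openin (top_of_set Z) u"
      "pairwise disjnt \<V>" "\<And>u. u \<in> \<V> \<Longrightarrow> \<exists>t. homeomorphism u W p t"
    using evenly_coveredE[OF W(4)] by metis
  \<comment> \<open>On the connected sheet \<open>u\<close> both maps lift \<open>p\<close> along
    \<open>q\<close>. They agree at \<open>z\<close> because \<open>s\<close> inverts
    \<open>q\<close> on \<open>V\<close>.\<close>
  have eq: "r w = (s \<circ> p) w" if u: "u \<in> \<V>" and z: "z \<in> u" "r z \<in> V" and w: "w \<in> u" for u z w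
  proof (rule covering_space_lift_unique_connected[OF q, of u r "s \<circ> p" z])
    obtain t where t: "homeomorphism u W p t" using \<V>(4)[OF u] by blast
    then show "connected u"
      using path_connected_imp_connected[OF W(3)] homeomorphism_def connected_continuous_image by metis
    have uZ: "u \<subseteq> Z" using openin_imp_subset[OF \<V>(2)[OF u]] .
    show "continuous_on u r" "r \<in> u \<rightarrow> Y" using uZ r continuous_on_subset by blast+
    have "continuous_on u p" "p ` u = W" using t by (auto simp: homeomorphism_def)
    then show "continuous_on u (s \<circ> p)" using s(1) continuous_on_compose by metis
    show "s \<circ> p \<in> u \<rightarrow> Y"
      using \<open>p ` u = W\<close> s(2) openin_imp_subset[OF V(2)] by auto
    show "q (r x) = q ((s \<circ> p) x)" if "x \<in> u" for x
      using that uZ r(3)[of x] homeomorphism_apply2[OF V(3), of "p x"] \<open>p ` u = W\<close> by auto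
    show "r z = (s \<circ> p) z"
      using z uZ r(3)[of z] homeomorphism_apply1[OF V(3), of "r z"] by auto
  qed (use z w in auto)
  \<comment> \<open>The sheets of \<open>r\<close> over \<open>V\<close> are the sheets of
    \<open>p\<close> over \<open>W\<close> that \<open>r\<close> sends into \<open>V\<close>; by
    \<open>eq\<close> it is enough that one point goes there.\<close>
  let ?\<W> = "{u \<in> \<V>. \<exists>z\<in>u. r z \<in> V}"
  have "\<Union>?\<W> = Z \<inter> r -` V"
  proof
    show "\<Union>?\<W> \<subseteq> Z \<inter> r -` V"
    proof
      fix w assume "w \<in> \<Union>?\<W>"
      then obtain u z where u: "u \<in> \<V>" "z \<in> u" "r z \<in> V" "w \<in> u" by blast
      then have "w \<in> Z \<inter> p -` W" using \<V>(1) by blast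
      then show "w \<in> Z \<inter> r -` V" using eq[OF u] s(2) by auto
    qed
    show "Z \<inter> r -` V \<subseteq> \<Union>?\<W>"
    proof
      fix z assume z: "z \<in> Z \<inter> r -` V"
      then have "p z \<in> W"
        using r(3)[of z] homeomorphism_image1[OF V(3)] by (metis IntD1 IntD2 imageI vimageD)
      then show "z \<in> \<Union>?\<W>" using z \<V>(1) by blast
    qed
  qed
  moreover have "\<exists>t. homeomorphism u V r t" if u: "u \<in> ?\<W>" for u
  proof -
    obtain t where t: "homeomorphism u W p t" using \<V>(4)[of u] u by auto
    have "homeomorphism u V (s \<circ> p) (t \<circ> q)"
      using homeomorphism_compose[OF t homeomorphism_symD[OF V(3)]] .
    moreover have "r w = (s \<circ> p) w" if "w \<in> u" for w
      using eq u that by blast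
    ultimately have "homeomorphism u V r (t \<circ> q)"
      by (rule homeomorphism_cong[OF _ refl refl _ refl])
    then show ?thesis by (rule exI[where x = "t \<circ> q"])
  qed
  moreover have "pairwise disjnt ?\<W>"
    using \<V>(3) by (rule pairwise_subset) blast
  ultimately have "evenly_covered Z r Y V"
    unfolding evenly_covered_def using V(2) \<V>(2) by (intro conjI exI[of _ ?\<W>] ballI) simp_all
  with V(1) show "\<exists>T. y \<in> T \<and> evenly_covered Z r Y T" by (intro exI[of _ V] conjI)
qed

theorem theorem3p12:
  fixes X :: "'a::topological_space set"
    and Xt :: "'b::topological_space set"
    and Yt :: "'c::topological_space set"
    and p :: "'b \<Rightarrow> 'a"
    and q :: "'c \<Rightarrow> 'a"
  assumes "path_connected X"
    and "locally path_connected X"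
    and "path_connected Xt"
    and "spanier_covering Xt p X"
    and "path_connected Yt"
    and "covering_space Yt q X"
  shows "\<exists>r. covering_space Xt r Yt \<and> (\<forall>z\<in>Xt. (q \<circ> r) z = p z)"
\<comment> \<open>The empty set counts as path connected. If \<open>Xt\<close> is empty,
  surjectivity of both coverings makes \<open>X\<close> and \<open>Yt\<close> empty as well.\<close>
proof (cases "Xt = {}")
  case True
  then have "Yt = {}"
    using assms(4,6) by (auto simp: spanier_covering_def covering_space_def)
  then show ?thesis using True by (simp add: covering_space_def)
next
  case False
  have p: "covering_space Xt p X" and spanier: "spanier_space Xt"
    using assms(4) by (auto simp: spanier_covering_def)
  obtain z where z: "z \<in> Xt" using False by blast
  then have "p z \<in> q ` Yt"
    using p assms(6) by (auto simp: covering_space_def)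
  \<comment> \<open>Any point of the fibre of \<open>q\<close> over \<open>p z\<close> may serve as
    the starting value of the lift.\<close>
  then obtain y where y: "y \<in> Yt" "q y = p z" by auto
  have sp: "fundamental_group Xt z = spanier_group Xt z"
    using spanier z by (simp add: spanier_space_def)
  obtain r where r: "continuous_on Xt r" "r \<in> Xt \<rightarrow> Yt" "\<And>z. z \<in> Xt \<Longrightarrow> q (r z) = p z"
    using covering_space_lift_spanier[OF assms(6,3) covering_space_locally_path_connected_domain[OF p assms(2)]
        covering_space_imp_continuous[OF p] covering_space_funcset[OF p] z y sp] by blast
  have "covering_space Xt r Yt"
    using covering_space_factor[OF p assms(6,2,5) False r] .
  then show ?thesis using r(3) by (intro exI[of _ r]) simp
qed

end
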